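(* Let $R$ be a finite non-local commutative ring with unity. Then $G_{\mathrm{Id}}(R)$ is a split graph if and only if $R\cong \mathbb{Z}_2\times\mathbb{Z}_2\times\cdots\times\mathbb{Z}_2$ (a finite direct product of at least two copies of $\mathbb{Z}_2$).
   Context: For a ring $R$ with unity, an element $x\in R$ is idempotent if $x^2=x$; $\mathrm{Id}(R)$ denotes the set of idempotents of $R$. The idempotent graph $G_{\mathrm{Id}}(R)$ is the simple undirected graph with vertex set $R$ in which two distinct vertices $x,y$ are adjacent if and only if $x+y\in \mathrm{Id}(R)$. A ring is local if it has a unique maximal ideal; non-local otherwise. A graph is a split graph if its vertex set is the disjoint union of a set inducing a complete subgraph and an independent set. *)

theory Defs
  imports
    "HOL-Algebra.Chinese_Remainder"
    "HOL-Number_Theory.Residues"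
    "Graph_Theory.Kuratowski"
begin

text \<open>The zero ring has no maximal ideal, so it is not local in this sense.\<close>

definition local_ring :: "('a, 'm) ring_scheme \<Rightarrow> bool" where
  "local_ring R \<longleftrightarrow> ring R \<and> (\<exists>!I. maximalideal I R)"

definition idempotents :: "('a, 'm) ring_scheme \<Rightarrow> 'a set" where
  "idempotents R = {x \<in> carrier R. x [^]\<^bsub>R\<^esub> (2::nat) = x}"

text \<open>Following the convention of \<^theory>\<open>Graph_Theory.Digraph\<close>, a simple undirected graph is a
  symmetric loop-free digraph without parallel arcs: an edge between \<open>x\<close> and \<open>y\<close> is the pair of
  arcs \<open>(x, y)\<close> and \<open>(y, x)\<close>.\<close>

definition idempotent_graph :: "('a, 'm) ring_scheme \<Rightarrow> 'a pair_pre_digraph" where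
  "idempotent_graph R =
     \<lparr> pverts = carrier R,
       parcs = {(x, y). x \<in> carrier R \<and> y \<in> carrier R \<and> x \<noteq> y \<and> x \<oplus>\<^bsub>R\<^esub> y \<in> idempotents R} \<rparr>"

lemma pair_graph_idempotent_graph:
  assumes "ring R" and "finite (carrier R)"
  shows "pair_graph (idempotent_graph R)"
proof -
  interpret ring R by fact
  have "parcs (idempotent_graph R) \<subseteq> carrier R \<times> carrier R"
    by (auto simp: idempotent_graph_def)
  then have fin: "finite (parcs (idempotent_graph R))"
    using assms(2) by (meson finite_SigmaI finite_subset)
  show ?thesis
  proof
    show "symmetric (with_proj (idempotent_graph R))"
      unfolding symmetric_def sym_def by (auto simp: idempotent_graph_def a_comm)
  qed (use fin assms(2) in \<open>auto simp: idempotent_graph_def\<close>)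
qed

text \<open>Either part may be empty.  The notion is meant for finite graphs, since \<^const>\<open>complete_digraph\<close>
  requires a finite vertex set.\<close>

definition split_graph :: "('a, 'b) pre_digraph \<Rightarrow> bool" where
  "split_graph G \<longleftrightarrow>
     (\<exists>K S. verts G = K \<union> S \<and> K \<inter> S = {} \<and>
        complete_digraph (card K) (G \<restriction> K) \<and> arcs (G \<restriction> S) = {})"

end

theory Submission
  imports Defs
begin

text \<open>
  Let \<open>K\<close> be the clique of a split partition: every edge meets \<open>K\<close>, and any two distinct elements
  of \<open>K\<close> have an idempotent sum.  If \<open>e \<noteq> 1\<close> is idempotent with \<open>2e \<noteq> 0\<close>, put \<open>f = 1 - e\<close>.  The edge
  \<open>{0, f}\<close> puts into \<open>K\<close> an element killed by \<open>e\<close>, which keeps \<open>f - e\<close> and \<open>-e\<close> out of \<open>K\<close> because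
  \<open>-e\<close> is not idempotent; the edges \<open>{e, f - e}\<close> and \<open>{1, -e}\<close> then force \<open>e\<close> and \<open>1\<close> into \<open>K\<close>, although
  \<open>e(e + 1) = 2e\<close> is not idempotent.  A finite non-local ring has an idempotent \<open>e \<noteq> 0, 1\<close>, and
  applying this to \<open>e\<close> and \<open>1 - e\<close> gives \<open>2 = 0\<close>.  Then the edges \<open>{0, 1}\<close> and \<open>{x, x + 1}\<close> show that
  every \<open>x\<close> is idempotent, and the Chinese remainder theorem for all maximal ideals, whose
  intersection is zero and whose residue fields have two elements, finishes the proof.
\<close>

section \<open>Maximal ideals and idempotents in finite rings\<close>

lemma (in cring) idempotents_iff: "x \<in> idempotents R \<longleftrightarrow> x \<in> carrier R \<and> x \<otimes> x = x"
  by (auto simp: idempotents_def numeral_2_eq_2)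

text \<open>There are only finitely many ideals, so those that contain \<open>I\<close> and avoid
  \<open>\<one>\<close> have a maximal member; avoiding \<open>\<one>\<close> is the same as being
  proper.\<close>

lemma (in ring) finite_proper_ideal_subset_maximal:
  assumes "finite (carrier R)" "ideal I R" "\<one> \<notin> I"
  obtains M where "maximalideal M R" "I \<subseteq> M"
proof -
  define F where "F = {J. ideal J R \<and> \<one> \<notin> J \<and> I \<subseteq> J}"
  have "F \<subseteq> Pow (carrier R)"
    by (auto simp: F_def dest: ideal.Icarr)
  then have "finite F"
    using assms(1) finite_subset by blast
  moreover have "I \<in> F"
    using assms by (simp add: F_def)
  ultimately obtain M where M: "M \<in> F" "I \<subseteq> M" "\<And>J. J \<in> F \<Longrightarrow> M \<subseteq> J \<Longrightarrow> J = M"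
    using finite_has_maximal2[of F I] by metis
  have "maximalideal M R"
  proof (rule maximalidealI)
    show "ideal M R"
      using M(1) by (simp add: F_def)
    show "carrier R \<noteq> M"
      using M(1) by (auto simp: F_def)
    show "J = M \<or> J = carrier R" if "ideal J R" "M \<subseteq> J" "J \<subseteq> carrier R" for J
    proof (cases "\<one> \<in> J")
      case True
      then show ?thesis
        using that(1) ideal.one_imp_carrier by metis
    next
      case False
      then have "J \<in> F"
        using that M(2) by (auto simp: F_def)
      then show ?thesis
        using that(2) M(3) by blast
    qed
  qed
  with M(2) show thesis
    using that by blast
qed

lemma finite_maximalideals:
  assumes "finite (carrier R)"
  shows "finite {M. maximalideal M R}"
proof (rule finite_subset)
  show "{M. maximalideal M R} \<subseteq> Pow (carrier R)"
    by (auto dest!: maximalideal.axioms(1) dest: ideal.Icarr)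
qed (use assms in simp)

lemma (in cring) maximalideal_one_notin:
  assumes "maximalideal M R"
  shows "\<one> \<notin> M"
  using assms ideal.one_imp_carrier maximalideal.I_notcarr maximalideal.axioms(1) by metis

text \<open>The powers of \<open>x\<close> repeat, so they are periodic from some exponent
  \<open>i\<close> on; at an exponent beyond \<open>i\<close> that is a multiple of the period,
  doubling the exponent changes nothing.\<close>

lemma (in monoid) finite_idempotent_power:
  assumes "finite (carrier G)" "x \<in> carrier G"
  obtains k :: nat where "k > 0" "x [^] k \<otimes> x [^] k = x [^] k"
proof -
  have "\<not> inj_on (\<lambda>k::nat. x [^] k) UNIV"
  proof
    assume "inj_on (\<lambda>k::nat. x [^] k) UNIV"
    moreover have "range (\<lambda>k::nat. x [^] k) \<subseteq> carrier G"
      using assms(2) by auto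
    ultimately show False
      using assms(1) finite_subset finite_imageD infinite_UNIV_nat by metis
  qed
  then obtain i j :: nat where "x [^] i = x [^] j" "i < j"
    by (metis injI linorder_neqE_nat)
  then obtain p where p: "p > 0" "x [^] i = x [^] (i + p)"
    by (metis less_imp_add_positive)
  have step: "x [^] (m + p) = x [^] m" if "i \<le> m" for m
  proof -
    obtain d where "m = i + d"
      using \<open>i \<le> m\<close> le_Suc_ex by blast
    then show ?thesis
      using p(2) assms(2) nat_pow_mult[of x "i + p" d] nat_pow_mult[of x i d]
      by (simp add: ac_simps)
  qed
  have steps: "x [^] (m + t * p) = x [^] m" if "i \<le> m" for m t
  proof (induction t)
    case (Suc t)
    then show ?case
      using step[of "m + t * p"] that by (simp add: ac_simps)
  qed simp
  \<comment> \<open>The factor \<open>Suc i\<close> lifts this multiple of the period above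
    \<open>i\<close> and keeps it positive even for \<open>i = 0\<close>.\<close>
  define m where "m = Suc i * p"
  have "i \<le> m" "m > 0"
    using p(1) by (simp_all add: m_def trans_le_add2)
  then have "x [^] m \<otimes> x [^] m = x [^] m"
    using steps[of m "Suc i"] assms(2) by (simp add: nat_pow_mult m_def)
  with \<open>m > 0\<close> show thesis
    using that by blast
qed

text \<open>Non-locality gives distinct maximal ideals \<open>M\<close> and \<open>N\<close>. For
  \<open>x\<close> in \<open>M\<close> but not in \<open>N\<close>, an idempotent power with
  positive exponent lies in \<open>M\<close>, so it is not \<open>\<one>\<close>, and avoids the
  prime ideal \<open>N\<close>, so it is not \<open>\<zero>\<close>.\<close>

lemma (in cring) nontrivial_idempotent:
  assumes "finite (carrier R)" "\<one> \<noteq> \<zero>" "\<not> local_ring R"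
  obtains e where "e \<in> idempotents R" "e \<noteq> \<zero>" "e \<noteq> \<one>"
proof -
  obtain M where M: "maximalideal M R"
    using finite_proper_ideal_subset_maximal[OF assms(1) zeroideal] assms(2) by blast
  then obtain N where N: "maximalideal N R" "N \<noteq> M"
    using assms(3) ring_axioms by (auto simp: local_ring_def)
  interpret M: maximalideal M R by fact
  interpret N: maximalideal N R by fact
  interpret N: primeideal N R
    using N(1) by (rule maximalideal_prime)
  have "\<not> M \<subseteq> N"
    using M.I_maximal[OF N.is_ideal _ N.a_subset] N(2) N.I_notcarr by auto
  then obtain x where x: "x \<in> M" "x \<notin> N"
    by blast
  then have xc: "x \<in> carrier R"
    using M.Icarr by blast
  then obtain k :: nat where k: "k > 0" "x [^] k \<otimes> x [^] k = x [^] k"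
    using finite_idempotent_power assms(1) by blast
  have notin: "x [^] m \<notin> N" for m :: nat
  proof (induction m)
    case 0
    then show ?case
      using maximalideal_one_notin[OF N(1)] by simp
  next
    case (Suc m)
    then show ?case
      using N.I_prime[of "x [^] m" x] x(2) xc by auto
  qed
  obtain l where "k = Suc l"
    using k(1) gr0_implies_Suc by blast
  then have "x [^] k \<in> M"
    using M.I_l_closed[OF x(1), of "x [^] l"] xc by simp
  show thesis
  proof
    show "x [^] k \<in> idempotents R"
      using k(2) xc by (simp add: idempotents_iff)
    show "x [^] k \<noteq> \<zero>"
      using notin N.zero_closed by metis
    show "x [^] k \<noteq> \<one>"
      using \<open>x [^] k \<in> M\<close> maximalideal_one_notin[OF M] by metis
  qed
qed

section \<open>Split partitions of the idempotent graph\<close>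

text \<open>Independence of the other part makes the clique \<open>K\<close> a vertex cover. The
  later arguments use a split partition only through these properties of \<open>K\<close>, free of
  the digraph encoding.\<close>

lemma split_idempotent_graphE:
  assumes "split_graph (with_proj (idempotent_graph R))"
  obtains K where "K \<subseteq> carrier R"
    "\<And>x y. \<lbrakk>x \<in> K; y \<in> K; x \<noteq> y\<rbrakk> \<Longrightarrow> x \<oplus>\<^bsub>R\<^esub> y \<in> idempotents R"
    "\<And>x y. \<lbrakk>x \<in> carrier R; y \<in> carrier R; x \<noteq> y; x \<oplus>\<^bsub>R\<^esub> y \<in> idempotents R\<rbrakk> \<Longrightarrow> x \<in> K \<or> y \<in> K"
proof -
  obtain K S where KS: "carrier R = K \<union> S"
    and K: "complete_digraph (card K) (with_proj (idempotent_graph R) \<restriction> K)"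
    and S: "arcs (with_proj (idempotent_graph R) \<restriction> S) = {}"
    using assms by (auto simp: split_graph_def idempotent_graph_def)
  have K': "arcs_ends (with_proj (idempotent_graph R) \<restriction> K) = {(u, v). (u, v) \<in> K \<times> K \<and> u \<noteq> v}"
    using K by (simp add: complete_digraph_def)
  show thesis
  proof
    show "K \<subseteq> carrier R"
      using KS by blast
    show "x \<oplus>\<^bsub>R\<^esub> y \<in> idempotents R" if "x \<in> K" "y \<in> K" "x \<noteq> y" for x y
    proof -
      have "(x, y) \<in> arcs_ends (with_proj (idempotent_graph R) \<restriction> K)"
        using that K' by simp
      then show ?thesis
        by (auto simp: arcs_ends_def arc_to_ends_def idempotent_graph_def)
    qed
    show "x \<in> K \<or> y \<in> K"
      if "x \<in> carrier R" "y \<in> carrier R" "x \<noteq> y" "x \<oplus>\<^bsub>R\<^esub> y \<in> idempotents R" for x y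
      using that S KS by (auto simp: idempotent_graph_def)
  qed
qed

text \<open>All sums are idempotent, so the graph is complete and the independent part can be taken
  empty.\<close>

lemma split_idempotent_graph_if_boolean:
  assumes "ring R" "finite (carrier R)" "carrier R \<subseteq> idempotents R"
  shows "split_graph (with_proj (idempotent_graph R))"
proof -
  interpret ring R by fact
  have "with_proj (idempotent_graph R) \<restriction> carrier R = with_proj (idempotent_graph R)"
    by (auto simp: induce_subgraph_def idempotent_graph_def with_proj_def)
  moreover have "complete_digraph (card (carrier R)) (with_proj (idempotent_graph R))"
    using assms(2,3) by (auto simp: complete_digraph_pair_def idempotent_graph_def)
  ultimately show ?thesis
    unfolding split_graph_def
    by (intro exI[of _ "carrier R"] exI[of _ "{}"]) (auto simp: idempotent_graph_def)
qed

lemma (in cring) split_idempotent_graph_double_idempotent_eq_zero: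
  assumes split: "split_graph (with_proj (idempotent_graph R))"
    and e: "e \<in> idempotents R" "e \<noteq> \<one>"
  shows "e \<oplus> e = \<zero>"
proof (rule ccontr)
  assume ee: "e \<oplus> e \<noteq> \<zero>"
  obtain K where Kc: "K \<subseteq> carrier R"
    and K: "\<And>x y. \<lbrakk>x \<in> K; y \<in> K; x \<noteq> y\<rbrakk> \<Longrightarrow> x \<oplus> y \<in> idempotents R"
    and cover: "\<And>x y. \<lbrakk>x \<in> carrier R; y \<in> carrier R; x \<noteq> y; x \<oplus> y \<in> idempotents R\<rbrakk> \<Longrightarrow> x \<in> K \<or> y \<in> K"
    using split_idempotent_graphE[OF split] by blast
  have ec: "e \<in> carrier R" "e \<otimes> e = e"
    using e(1) by (simp_all add: idempotents_iff)
  define f where "f = \<one> \<ominus> e"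
  have fc: "f \<in> carrier R" and ef: "e \<otimes> f = \<zero>" and ff: "f \<in> idempotents R"
    using ec by (auto simp: f_def idempotents_iff minus_eq l_distr r_distr l_minus r_minus a_ac l_neg r_neg)
  have f0: "f \<noteq> \<zero>"
    using e(2) ec(1) by (simp add: f_def)
  \<comment> \<open>Since \<open>\<ominus> e\<close> squares to \<open>e\<close>, this says that
    \<open>\<ominus> e\<close> is not idempotent.\<close>
  have neg: "\<ominus> e \<noteq> e"
    using ee ec(1) l_neg by metis
  obtain g where g: "g \<in> K" "e \<otimes> g = \<zero>"
    using cover[of \<zero> f] f0 fc ff ef ec(1) by auto
  \<comment> \<open>Multiplying the idempotent \<open>g \<oplus> y\<close> by \<open>e\<close> would
    make \<open>e \<otimes> y = \<ominus> e\<close> idempotent.\<close>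
  have minus: "e \<otimes> y \<noteq> \<ominus> e" if "y \<in> K" for y
  proof
    assume ey: "e \<otimes> y = \<ominus> e"
    have gy: "g \<in> carrier R" "y \<in> carrier R"
      using g(1) that Kc by auto
    have "g \<noteq> y"
      using ey g(2) ec(1) neg by (metis minus_minus minus_zero)
    then have "(g \<oplus> y) \<otimes> (g \<oplus> y) = g \<oplus> y"
      using K g(1) that by (simp add: idempotents_iff)
    then have "e \<otimes> (g \<oplus> y) \<otimes> (e \<otimes> (g \<oplus> y)) = e \<otimes> (g \<oplus> y)"
      using gy ec by (metis a_closed m_assoc m_comm m_closed)
    then show False
      using ey g(2) gy ec neg by (simp add: r_distr l_minus r_minus)
  qed
  \<comment> \<open>This keeps \<open>f \<ominus> e\<close> out of \<open>K\<close> by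
    \<open>minus\<close>, and also separates it from \<open>e\<close>, whose product with
    \<open>e\<close> is \<open>e\<close>.\<close>
  have "e \<otimes> (f \<ominus> e) = \<ominus> e"
    using ec fc ef by (simp add: minus_eq r_distr r_minus)
  moreover have "e \<oplus> (f \<ominus> e) = f"
    using ec(1) fc by algebra
  ultimately have "e \<in> K"
    using cover[of e "f \<ominus> e"] minus[of "f \<ominus> e"] ec fc ff neg by (metis minus_closed)
  moreover have "\<one> \<in> K"
  proof -
    have "e \<otimes> \<ominus> e = \<ominus> e"
      using ec by (simp add: r_minus)
    moreover from this have "\<one> \<noteq> \<ominus> e"
      using ec(1) neg by (metis r_one)
    ultimately show ?thesis
      using cover[of \<one> "\<ominus> e"] minus[of "\<ominus> e"] ec(1) ff by (auto simp: f_def minus_eq)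
  qed
  ultimately have idem: "(e \<oplus> \<one>) \<otimes> (e \<oplus> \<one>) = e \<oplus> \<one>"
    using K e(2) by (simp add: idempotents_iff)
  \<comment> \<open>The square exceeds \<open>e \<oplus> \<one>\<close> by exactly
    \<open>e \<oplus> e\<close>, so idempotence cancels to the excluded equation.\<close>
  have "(e \<oplus> \<one>) \<otimes> (e \<oplus> \<one>) = (e \<oplus> \<one>) \<oplus> (e \<oplus> e)"
    using ec by (simp add: l_distr r_distr a_ac)
  then show False
    using idem ee ec(1) by simp
qed

text \<open>Both \<open>\<zero>, \<one>\<close> and \<open>x, x \<oplus> \<one>\<close> are pairs
  with sum \<open>\<one>\<close>, so \<open>K\<close> contains a member \<open>b\<close> of the
  first and \<open>a\<close> of the second. If \<open>a = b\<close>, then \<open>a\<close> is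
  \<open>\<zero>\<close> or \<open>\<one>\<close>; otherwise \<open>a \<oplus> b\<close> is
  idempotent and equals \<open>a\<close> or \<open>a \<oplus> \<one>\<close>. In characteristic two,
  adding \<open>\<one>\<close> preserves idempotence, which leads back to \<open>x\<close>.\<close>

lemma (in cring) split_idempotent_graph_boolean:
  assumes split: "split_graph (with_proj (idempotent_graph R))"
    and two: "\<one> \<oplus> \<one> = \<zero>" and "\<one> \<noteq> \<zero>"
  shows "carrier R \<subseteq> idempotents R"
proof
  fix x assume x: "x \<in> carrier R"
  obtain K where Kc: "K \<subseteq> carrier R"
    and K: "\<And>x y. \<lbrakk>x \<in> K; y \<in> K; x \<noteq> y\<rbrakk> \<Longrightarrow> x \<oplus> y \<in> idempotents R"
    and cover: "\<And>x y. \<lbrakk>x \<in> carrier R; y \<in> carrier R; x \<noteq> y; x \<oplus> y \<in> idempotents R\<rbrakk> \<Longrightarrow> x \<in> K \<or> y \<in> K"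
    using split_idempotent_graphE[OF split] by blast
  have shift: "z \<in> idempotents R" if "z \<in> carrier R" "z \<oplus> \<one> \<in> idempotents R" for z
  proof -
    have "z \<otimes> z \<oplus> \<one> \<oplus> (z \<oplus> z) = (z \<oplus> \<one>) \<otimes> (z \<oplus> \<one>)"
      using that(1) by (simp add: l_distr r_distr a_ac)
    moreover have "z \<oplus> z = z \<otimes> (\<one> \<oplus> \<one>)"
      using that(1) by (simp add: r_distr del: two)
    ultimately show ?thesis
      using that two by (simp add: idempotents_iff)
  qed
  have idem01: "\<zero> \<in> idempotents R" "\<one> \<in> idempotents R"
    by (simp_all add: idempotents_iff)
  have xx: "x \<oplus> (x \<oplus> \<one>) = \<one>"
  proof -
    have "x \<oplus> (x \<oplus> \<one>) = x \<otimes> (\<one> \<oplus> \<one>) \<oplus> \<one>"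
      using x by (simp add: r_distr a_ac)
    then show ?thesis
      using x two by simp
  qed
  have ne: "x \<noteq> x \<oplus> \<one>"
    using x \<open>\<one> \<noteq> \<zero>\<close> by simp
  obtain a where a: "a \<in> K" "a = x \<or> a = x \<oplus> \<one>"
    using cover[OF x _ ne] x xx idem01(2) by auto
  obtain b where b: "b \<in> K" "b = \<zero> \<or> b = \<one>"
    using cover[of \<zero> \<one>] idem01(2) \<open>\<one> \<noteq> \<zero>\<close> by auto
  have "a \<in> idempotents R \<or> a \<oplus> \<one> \<in> idempotents R"
  proof (cases "a = b")
    case True
    then show ?thesis
      using b(2) idem01 by auto
  next
    case False
    then have "a \<oplus> b \<in> idempotents R"
      using K a(1) b(1) by blast
    then show ?thesis
      using b a Kc by auto
  qed
  then have "a \<in> idempotents R"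
    using shift[of a] a Kc by blast
  then show "x \<in> idempotents R"
    using shift[OF x] a(2) by blast
qed

section \<open>Finite Boolean rings as powers of the two-element field\<close>

text \<open>Idempotence reads \<open>x \<otimes> (x \<ominus> \<one>) = \<zero>\<close>, which
  leaves only \<open>\<zero>\<close> and \<open>\<one>\<close>; their sum table is then
  forced.\<close>

lemma (in domain) boolean_domain_iso:
  assumes "carrier R \<subseteq> idempotents R"
  shows "R \<simeq> residue_ring 2"
proof -
  have cases: "x = \<zero> \<or> x = \<one>" if "x \<in> carrier R" for x
  proof -
    have "x \<otimes> (x \<ominus> \<one>) = \<zero>"
      using that assms by (auto simp: idempotents_iff minus_eq r_distr r_minus r_neg)
    then show ?thesis
      using that integral[of x "x \<ominus> \<one>"] by auto
  qed
  then have carr: "carrier R = {\<zero>, \<one>}"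
    by auto
  have "\<one> \<oplus> \<one> \<noteq> \<one>"
    by auto
  then have two: "\<one> \<oplus> \<one> = \<zero>"
    using cases[of "\<one> \<oplus> \<one>"] by simp
  have "(\<lambda>x. if x = \<zero> then 0 else 1) \<in> ring_iso R (residue_ring 2)"
    by (rule ring_iso_memI)
       (auto simp: residue_ring_def carr two bij_betw_def inj_on_def image_def)
  then show ?thesis
    by (auto simp: is_ring_iso_def)
qed

text \<open>Lets each residue field in the Chinese remainder product be replaced by
  \<open>residue_ring 2\<close>. The induction passes through the binary product of head and tail,
  where isomorphisms act componentwise.\<close>

lemma RDirProd_list_iso_cong:
  fixes Rs :: "('a, 'm) ring_scheme list" and Ss :: "('b, 'n) ring_scheme list"
  assumes "list_all2 (\<lambda>R S. R \<simeq> S) Rs Ss"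
  shows "RDirProd_list Rs \<simeq> RDirProd_list Ss"
  using assms
proof (induction rule: list_all2_induct)
  case Nil
  have "(\<lambda>_. []) \<in> ring_iso (nil_ring :: 'a list ring) (nil_ring :: 'b list ring)"
    by (rule ring_iso_memI) (auto simp: monoid.defs bij_betw_def)
  then show ?case
    by (auto simp: is_ring_iso_def)
next
  case (Cons R Rs S Ss)
  obtain f g where "f \<in> ring_iso R S" "g \<in> ring_iso (RDirProd_list Rs) (RDirProd_list Ss)"
    using Cons by (auto simp: is_ring_iso_def)
  then have "(\<lambda>(r, s). (f r, g s)) \<in> ring_iso (RDirProd R (RDirProd_list Rs)) (RDirProd S (RDirProd_list Ss))"
    by (rule RDirProd_iso6)
  from ring_iso_set_trans[OF ring_iso_set_trans[OF RDirProd_list_iso2 this] RDirProd_list_iso1]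
  show ?case
    by (auto simp: is_ring_iso_def)
qed

text \<open>Prefixing a component is a ring homomorphism from the binary product to the list
  product.\<close>

lemma RDirProd_list_mult:
  assumes "a \<in> carrier R" "b \<in> carrier R" "as \<in> carrier (RDirProd_list Rs)" "bs \<in> carrier (RDirProd_list Rs)"
  shows "(a # as) \<otimes>\<^bsub>RDirProd_list (R # Rs)\<^esub> (b # bs) = (a \<otimes>\<^bsub>R\<^esub> b) # (as \<otimes>\<^bsub>RDirProd_list Rs\<^esub> bs)"
  using ring_hom_mult[OF RDirProd_list_hom1[of R Rs], of "(a, as)" "(b, bs)"] assms
  by (simp add: RDirProd_carrier RDirProd_def DirProd_def monoid.defs)

lemma RDirProd_list_boolean:
  assumes "\<And>R a. \<lbrakk>R \<in> set Rs; a \<in> carrier R\<rbrakk> \<Longrightarrow> a \<otimes>\<^bsub>R\<^esub> a = a"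
    and "as \<in> carrier (RDirProd_list Rs)"
  shows "as \<otimes>\<^bsub>RDirProd_list Rs\<^esub> as = as"
  using assms
proof (induction Rs arbitrary: as)
  case Nil
  then show ?case
    by (simp add: monoid.defs)
next
  case (Cons R Rs)
  then obtain b bs where "as = b # bs" "b \<in> carrier R" "bs \<in> carrier (RDirProd_list Rs)"
    by (auto simp: RDirProd_list_carrier)
  with Cons show ?case
    by (simp add: RDirProd_list_mult)
qed

lemma (in ideal) quotient_boolean:
  assumes "\<And>x. x \<in> carrier R \<Longrightarrow> x \<otimes> x = x" "y \<in> carrier (R Quot I)"
  shows "y \<otimes>\<^bsub>R Quot I\<^esub> y = y"
proof -
  obtain x where "x \<in> carrier R" "y = I +> x"
    using assms(2) by (auto simp: FactRing_def A_RCOSETS_def')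
  with ring_hom_mult[OF rcos_ring_hom, of x x] assms(1) show ?thesis
    by simp
qed

text \<open>If \<open>x\<close> lies in every maximal ideal, then
  \<open>y = \<one> \<ominus> x\<close> lies in none and is a unit; since
  \<open>x \<otimes> y = \<zero>\<close>, this gives \<open>x = \<zero>\<close>.\<close>

lemma (in cring) finite_boolean_maximal_Inter:
  assumes "finite (carrier R)" "carrier R \<subseteq> idempotents R" "\<one> \<noteq> \<zero>"
  shows "\<Inter> {M. maximalideal M R} = {\<zero>}"
proof (intro equalityI subsetI)
  fix x assume x: "x \<in> \<Inter> {M. maximalideal M R}"
  obtain M0 where M0: "maximalideal M0 R"
    using finite_proper_ideal_subset_maximal[OF assms(1) zeroideal] assms(3) by blast
  then have xc: "x \<in> carrier R"
    using x ideal.Icarr[OF maximalideal.axioms(1)[OF M0]] by blast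
  define y where "y = \<one> \<ominus> x"
  have yc: "y \<in> carrier R"
    using xc by (simp add: y_def)
  have "x \<otimes> x = x"
    using xc assms(2) by (auto simp: idempotents_iff)
  then have xy: "x \<otimes> y = \<zero>"
    using xc by (simp add: y_def minus_eq r_distr r_minus r_neg)
  have sum: "x \<oplus> y = \<one>"
    using xc unfolding y_def by algebra
  have "\<one> \<in> PIdl y"
  proof (rule ccontr)
    assume "\<one> \<notin> PIdl y"
    then obtain M where M: "maximalideal M R" "PIdl y \<subseteq> M"
      using finite_proper_ideal_subset_maximal[OF assms(1) cgenideal_ideal[OF yc]] by blast
    interpret M: maximalideal M R by fact
    have "x \<oplus> y \<in> M"
      using x M cgenideal_self[OF yc] by auto
    then show False
      using sum maximalideal_one_notin[OF M(1)] by simp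
  qed
  then obtain z where "z \<in> carrier R" "\<one> = z \<otimes> y"
    by (auto simp: cgenideal_def)
  then have "x = z \<otimes> (x \<otimes> y)"
    using xc yc by (metis m_lcomm r_one)
  then show "x \<in> {\<zero>}"
    using xy \<open>z \<in> carrier R\<close> by simp
next
  fix x assume "x \<in> {\<zero>}"
  then show "x \<in> \<Inter> {M. maximalideal M R}"
    using additive_subgroup.zero_closed ideal.axioms(1) maximalideal.axioms(1) by fastforce
qed

text \<open>If the sum were proper, maximality would make it equal to both \<open>M\<close> and
  \<open>N\<close>. This is the comaximality that the Chinese remainder theorem asks for.\<close>

lemma (in ring) maximalideals_sum:
  assumes "maximalideal M R" "maximalideal N R" "M \<noteq> N"
  shows "M <+> N = carrier R"
proof -
  interpret M: maximalideal M R by fact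
  interpret N: maximalideal N R by fact
  have sum: "ideal (M <+> N) R"
    by (rule add_ideals[OF M.is_ideal N.is_ideal])
  have "M \<subseteq> M <+> N" "N \<subseteq> M <+> N"
    using union_genideal[OF M.is_ideal N.is_ideal] genideal_self[of "M \<union> N"] M.a_subset N.a_subset by auto
  then show ?thesis
    using M.I_maximal[OF sum] N.I_maximal[OF sum] ideal.Icarr[OF sum] assms(3) by blast
qed

lemma (in cring) finite_boolean_iso:
  assumes fin: "finite (carrier R)" and bool: "carrier R \<subseteq> idempotents R" and "\<one> \<noteq> \<zero>"
  shows "R \<simeq> RDirProd_list (replicate (card {M. maximalideal M R}) (residue_ring 2))"
proof -
  let ?X = "{M. maximalideal M R}"
  have "finite ?X"
    using fin by (rule finite_maximalideals)
  obtain M0 where "M0 \<in> ?X"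
    using finite_proper_ideal_subset_maximal[OF fin zeroideal] assms(3) by blast
  \<comment> \<open>\<open>chinese_remainder\<close> indexes its ideals by \<open>{..n}\<close>, so
    the number of maximal ideals is written as a successor.\<close>
  then obtain n where n: "card ?X = Suc n"
    using \<open>finite ?X\<close> by (metis card_Suc_Diff1)
  obtain I where I: "bij_betw I {..n} ?X"
    using ex_bij_betw_nat_finite[OF \<open>finite ?X\<close>] n by (metis atLeast0LessThan lessThan_Suc_atMost)
  have max: "maximalideal (I i) R" if "i \<le> n" for i
    using I that by (auto simp: bij_betw_def)
  have "R Quot (\<Inter>i\<le>n. I i) \<simeq> RDirProd_list (map (\<lambda>i. R Quot (I i)) [0..<Suc n])"
  proof (rule chinese_remainder)
    show "ideal (I i) R" if "i \<le> n" for i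
      using max[OF that] by (rule maximalideal.axioms(1))
    show "I i <+> I j = carrier R" if "i \<le> n" "j \<le> n" "i \<noteq> j" for i j
      using maximalideals_sum[OF max max] that bij_betw_imp_inj_on[OF I] by (metis atMost_iff inj_onD)
  qed
  moreover have "(\<Inter>i\<le>n. I i) = {\<zero>}"
    using finite_boolean_maximal_Inter[OF fin bool assms(3)] I by (simp add: bij_betw_def)
  moreover have "R \<simeq> R Quot {\<zero>}"
    using ring_iso_sym[OF ring_axioms] FactRing_zeroideal by blast
  moreover have "RDirProd_list (map (\<lambda>i. R Quot (I i)) [0..<Suc n]) \<simeq>
      RDirProd_list (replicate (Suc n) (residue_ring 2))"
  proof (rule RDirProd_list_iso_cong, rule list_all2_all_nthI)
    fix i assume "i < length (map (\<lambda>i. R Quot (I i)) [0..<Suc n])"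
    then have "i \<le> n" by simp
    interpret M: maximalideal "I i" R
      using max[OF \<open>i \<le> n\<close>] .
    interpret Q: field "R Quot (I i)"
      by (rule M.quotient_is_field[OF cring_axioms])
    have "x \<otimes> x = x" if "x \<in> carrier R" for x
      using bool that by (auto simp: idempotents_iff)
    then have "carrier (R Quot (I i)) \<subseteq> idempotents (R Quot (I i))"
      using M.quotient_boolean by (intro subsetI) (simp add: Q.idempotents_iff)
    then have "R Quot (I i) \<simeq> residue_ring 2"
      by (rule Q.boolean_domain_iso)
    then show "map (\<lambda>i. R Quot (I i)) [0..<Suc n] ! i \<simeq> replicate (Suc n) (residue_ring 2) ! i"
      using \<open>i \<le> n\<close> by (simp del: upt_Suc replicate_Suc)
  qed simp
  ultimately show ?thesis
    unfolding n using ring_iso_trans by metis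
qed

text \<open>Squaring fixes every tuple over \<open>residue_ring 2\<close>, and injectivity of the
  isomorphism carries this back to \<open>R\<close>.\<close>

lemma (in cring) boolean_if_iso:
  assumes "R \<simeq> RDirProd_list (replicate n (residue_ring 2))"
  shows "carrier R \<subseteq> idempotents R"
proof
  fix x assume x: "x \<in> carrier R"
  let ?D = "RDirProd_list (replicate n (residue_ring 2))"
  obtain h where h: "h \<in> ring_iso R ?D"
    using assms by (auto simp: is_ring_iso_def)
  have "a \<otimes>\<^bsub>residue_ring 2\<^esub> a = a" if "a \<in> carrier (residue_ring 2)" for a
  proof -
    have "a = 0 \<or> a = 1"
      using that by (auto simp: residue_ring_def)
    then show ?thesis
      by (auto simp: residue_ring_def)
  qed
  then have "h x \<otimes>\<^bsub>?D\<^esub> h x = h x"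
    using ring_iso_memE(1)[OF h x] by (intro RDirProd_list_boolean) auto
  then have "h (x \<otimes> x) = h x"
    using ring_iso_memE(2)[OF h x x] by simp
  then have "x \<otimes> x = x"
    using ring_iso_memE(5)[OF h] x by (auto simp: bij_betw_def inj_on_def)
  with x show "x \<in> idempotents R"
    by (simp add: idempotents_iff)
qed

theorem theorem4p1:
  fixes R :: "('a, 'm) ring_scheme"
  assumes "cring R"
    and "\<one>\<^bsub>R\<^esub> \<noteq> \<zero>\<^bsub>R\<^esub>"
    and "finite (carrier R)"
    and "\<not> local_ring R"
  shows "split_graph (with_proj (idempotent_graph R)) \<longleftrightarrow>
    (\<exists>n\<ge>2. R \<simeq> RDirProd_list (replicate n (residue_ring 2)))"
proof
  interpret cring R by fact
  assume split: "split_graph (with_proj (idempotent_graph R))"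
  obtain e where e: "e \<in> idempotents R" "e \<noteq> \<zero>\<^bsub>R\<^esub>" "e \<noteq> \<one>\<^bsub>R\<^esub>"
    using nontrivial_idempotent[OF assms(3,2,4)] .
  have ec: "e \<in> carrier R" "e \<otimes>\<^bsub>R\<^esub> e = e"
    using e(1) by (simp_all add: idempotents_iff)
  define f where "f = \<one>\<^bsub>R\<^esub> \<ominus>\<^bsub>R\<^esub> e"
  have f: "f \<in> idempotents R" "f \<in> carrier R"
    using ec by (auto simp: f_def idempotents_iff minus_eq l_distr r_distr l_minus r_minus a_ac l_neg r_neg)
  have sum: "\<one>\<^bsub>R\<^esub> = e \<oplus>\<^bsub>R\<^esub> f"
    using ec(1) unfolding f_def by algebra
  have "f \<noteq> \<one>\<^bsub>R\<^esub>"
    using sum e(2) ec(1) f(2) by auto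
  note double = split_idempotent_graph_double_idempotent_eq_zero[OF split]
  \<comment> \<open>\<open>double\<close> excludes the idempotent \<open>1\<close> itself, so
    \<open>1\<close> is split into the idempotents \<open>e\<close> and \<open>f\<close>, both
    different from \<open>1\<close>.\<close>
  have "\<one>\<^bsub>R\<^esub> \<oplus>\<^bsub>R\<^esub> \<one>\<^bsub>R\<^esub> = (e \<oplus>\<^bsub>R\<^esub> e) \<oplus>\<^bsub>R\<^esub> (f \<oplus>\<^bsub>R\<^esub> f)"
    unfolding sum using ec(1) f(2) by (simp add: a_ac)
  then have "\<one>\<^bsub>R\<^esub> \<oplus>\<^bsub>R\<^esub> \<one>\<^bsub>R\<^esub> = \<zero>\<^bsub>R\<^esub>"
    using double[OF e(1,3)] double[OF f(1) \<open>f \<noteq> \<one>\<^bsub>R\<^esub>\<close>] by simp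
  then have bool: "carrier R \<subseteq> idempotents R"
    using split_idempotent_graph_boolean[OF split] assms(2) by blast
  let ?X = "{M. maximalideal M R}"
  obtain M where M: "maximalideal M R"
    using finite_proper_ideal_subset_maximal[OF assms(3) zeroideal] assms(2) by blast
  \<comment> \<open>Non-locality enters again: a second maximal ideal makes the number of factors at
    least two.\<close>
  then obtain N where N: "maximalideal N R" "N \<noteq> M"
    using assms(4) ring_axioms by (auto simp: local_ring_def)
  have "finite ?X"
    using assms(3) by (rule finite_maximalideals)
  then have "card {M, N} \<le> card ?X"
    using M N by (intro card_mono) auto
  then have "2 \<le> card ?X"
    using N(2) by simp
  then show "\<exists>n\<ge>2. R \<simeq> RDirProd_list (replicate n (residue_ring 2))"
    using finite_boolean_iso[OF assms(3) bool assms(2)] by blast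
next
  interpret cring R by fact
  assume "\<exists>n\<ge>2. R \<simeq> RDirProd_list (replicate n (residue_ring 2))"
  then show "split_graph (with_proj (idempotent_graph R))"
    using split_idempotent_graph_if_boolean[OF ring_axioms assms(3)] boolean_if_iso by blast
qed

end
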